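(* Let $(\overline{x},\overline{v})\in{\rm gph}\,\mathcal{N}_{\Gamma}$. Suppose that the multifunction $\mathcal{G}$ is metrically subregular at $\overline{x}$ for the origin. If the mapping $\Phi$ is metrically subregular at each $(\overline{x},\lambda,\overline{v})$ with $\lambda\in\mathcal{M}_{\overline{x}}(\overline{v})$ for the origin, then $$\mathcal{T}_{{\rm gph}\mathcal{N}_{\Gamma}}(\overline{x},\overline{v})\supseteq\bigcup_{\lambda\in\mathcal{M}_{\overline{x}}(\overline{v})}\Big\{(d,w)\in\mathbb{X}\times\mathbb{X}\ |\ w\in \nabla^2\langle\lambda,g\rangle(\overline{x})d+\nabla g(\overline{x})D\mathcal{N}_K(g(\overline{x})|\lambda)(g'(\overline{x})d)\Big\}.$$
   Context: $\mathbb{X},\mathbb{Y}$ are finite-dimensional real inner product spaces; $g:\mathbb{X}\to\mathbb{Y}$ is twice continuously differentiable; $K\subseteq\mathbb{Y}$ is a nonempty closed convex set that is $C^2$-cone reducible, i.e. for every $\overline{y}\in K$ there exist an open neighborhood $\mathcal{Y}$ of $\overline{y}$, a finite-dimensional space $\mathbb{Z}$, a pointed closed convex cone $D\subseteq\mathbb{Z}$ and a twice continuously differentiable $\Xi:\mathcal{Y}\to\mathbb{Z}$ with $\Xi(\overline{y})=0$, $\Xi'(\overline{y})$ onto, and $K\cap\mathcal{Y}=\{y\in\mathcal{Y}\,|\,\Xi(y)\in D\}$. $g'(x)$ is the derivative, $\nabla g(x):\mathbb{Y}\to\mathbb{X}$ is the adjoint of $g'(x)$, and $\nabla^2\langle\lambda,g\rangle(x)$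 is the Hessian at $x$ of $\langle\lambda,g(\cdot)\rangle$. $\Gamma:=g^{-1}(K)$; $\mathcal{G}(x):=g(x)-K$; $\mathcal{M}_{x}(v):=\{\lambda\in\mathcal{N}_K(g(x))\,|\,v=\nabla g(x)\lambda\}$ for $x\in\Gamma$, $v\in\mathbb{X}$; and, with $\Pi_K$ the projection onto $K$, $$\Phi(x,\lambda,v):=\big(-v+\nabla g(x)\lambda,\ g(x)-\Pi_K(g(x)+\lambda)\big),\quad (x,\lambda,v)\in\mathbb{X}\times\mathbb{Y}\times\mathbb{X}.$$ Contingent cone: $\mathcal{T}_\Omega(\overline{z})=\{w\,|\,\exists t_k\downarrow0,\,w^k\to w,\ \overline{z}+t_kw^k\in\Omega\}$. Regular normal cone: $\widehat{\mathcal{N}}_\Omega(\overline{z})=\{v\,|\,\limsup_{z\to\overline{z},\,z\in\Omega}\langle v,z-\overline{z}\rangle/\|z-\overline{z}\|\le0\}$ for $\overline{z}\in\Omega$ (empty otherwise); limiting normal cone: $\mathcal{N}_\Omega(\overline{z})=\limsup_{z\to\overline{z},\,z\in\Omega}\widehat{\mathcal{N}}_\Omega(z)$ (outer limit). For the convex set $K$ they coincide; metric subregularity of $\mathcal{G}$ at $\overline{x}$ for $0$ ensures they coincide for $\Gamma$ at points of $\Gamma$ near $\overline{x}$. Graphical derivative of $\mathcal{F}:\mathbb{Z}\rightrightarrows\mathbb{W}$ at $(\overline{z},\overline{w})\in{\rm gph}\mathcal{F}$: $\Delta w\in D\mathcal{F}(\overline{z}|\overline{w})(\Delta z)$ iff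 $(\Delta z,\Delta w)\in\mathcal{T}_{{\rm gph}\mathcal{F}}(\overline{z},\overline{w})$. $\mathcal{F}$ is metrically subregular at $\overline{z}$ for $\overline{w}\in\mathcal{F}(\overline z)$ if there are $\kappa\ge0$, $\varepsilon,\delta>0$ with ${\rm dist}(z,\mathcal{F}^{-1}(\overline{w}))\le\kappa\,{\rm dist}(\overline{w},\mathcal{F}(z)\cap\mathbb{B}(\overline{w},\delta))$ for all $z\in\mathbb{B}(\overline{z},\varepsilon)$ (distance to the empty set is $+\infty$; $\mathbb{B}(z,r)$ is the closed ball). *)

theory Defs
  imports "HOL-Analysis.Analysis"
begin

section \<open>Smoothness, gradients and Hessians\<close>

(* Only used for open S, so that the derivatives at points of S are determined by f on S. *)
definition C2_on :: "('a::euclidean_space \<Rightarrow> 'b::euclidean_space) \<Rightarrow> 'a set \<Rightarrow> bool" where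
  "C2_on f S \<longleftrightarrow>
     (\<exists>(f' :: 'a \<Rightarrow> 'a \<Rightarrow>\<^sub>L 'b) (f'' :: 'a \<Rightarrow> 'a \<Rightarrow>\<^sub>L ('a \<Rightarrow>\<^sub>L 'b)).
        (\<forall>x\<in>S. (f has_derivative blinfun_apply (f' x)) (at x)) \<and>
        (\<forall>x\<in>S. (f' has_derivative blinfun_apply (f'' x)) (at x)) \<and>
        continuous_on S f'')"

definition nabla :: "('a::euclidean_space \<Rightarrow> 'b::euclidean_space) \<Rightarrow> 'a \<Rightarrow> 'b \<Rightarrow> 'a" where
  "nabla f x = adjoint (frechet_derivative f (at x))"

(* For a real-valued phi, nabla phi z 1 is the gradient vector of phi at z; the Hessian is
   the derivative of the gradient, as a linear operator. *)
definition hessian :: "('a::euclidean_space \<Rightarrow> real) \<Rightarrow> 'a \<Rightarrow> 'a \<Rightarrow> 'a" where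
  "hessian \<phi> x = frechet_derivative (\<lambda>z. nabla \<phi> z 1) (at x)"

section \<open>Tangent and normal cones, graphical derivative, metric subregularity\<close>

definition contingent_cone :: "'a::real_normed_vector set \<Rightarrow> 'a \<Rightarrow> 'a set" where
  "contingent_cone \<Omega> z =
     {w. \<exists>(t :: nat \<Rightarrow> real) (u :: nat \<Rightarrow> 'a).
           (\<forall>k. t k > 0) \<and> t \<longlonglongrightarrow> 0 \<and> u \<longlonglongrightarrow> w \<and> (\<forall>k. z + t k *\<^sub>R u k \<in> \<Omega>)}"

(* The filter excludes z itself; at an isolated point the Limsup is that over the trivial
   filter, which is minus infinity, so every v is a regular normal there. *)
definition regular_normal_cone :: "'a::real_inner set \<Rightarrow> 'a \<Rightarrow> 'a set" where
  "regular_normal_cone \<Omega> z =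
     {v. z \<in> \<Omega> \<and>
         Limsup (at z within \<Omega>) (\<lambda>y. ereal (v \<bullet> (y - z) / norm (y - z))) \<le> 0}"

definition limiting_normal_cone :: "'a::real_inner set \<Rightarrow> 'a \<Rightarrow> 'a set" where
  "limiting_normal_cone \<Omega> z =
     {v. \<exists>(y :: nat \<Rightarrow> 'a) (u :: nat \<Rightarrow> 'a).
           (\<forall>k. y k \<in> \<Omega>) \<and> y \<longlonglongrightarrow> z \<and> u \<longlonglongrightarrow> v \<and>
           (\<forall>k. u k \<in> regular_normal_cone \<Omega> (y k))}"

definition gph :: "('a \<Rightarrow> 'b set) \<Rightarrow> ('a \<times> 'b) set" where
  "gph F = {(z, w). w \<in> F z}"

definition graphical_derivative ::
    "('a::real_normed_vector \<Rightarrow> 'b::real_normed_vector set) \<Rightarrow> 'a \<Rightarrow> 'b \<Rightarrow> 'a \<Rightarrow> 'b set" where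
  "graphical_derivative F z w dz = {dw. (dz, dw) \<in> contingent_cone (gph F) (z, w)}"

(* Unlike the library's infdist, the distance to the empty set is infinity. *)
definition edist :: "'a::metric_space \<Rightarrow> 'a set \<Rightarrow> ereal" where
  "edist z A = (INF a\<in>A. ereal (dist z a))"

(* A constant kappa can always be enlarged, so the convention 0 * infinity = 0 of ereal
   does not affect the notion. *)
definition metrically_subregular ::
    "('a::metric_space \<Rightarrow> 'b::metric_space set) \<Rightarrow> 'a \<Rightarrow> 'b \<Rightarrow> bool" where
  "metrically_subregular F z\<^sub>0 w\<^sub>0 \<longleftrightarrow>
     w\<^sub>0 \<in> F z\<^sub>0 \<and>
     (\<exists>(\<kappa>::real) (\<epsilon>::real) (\<delta>::real). \<kappa> \<ge> 0 \<and> \<epsilon> > 0 \<and> \<delta> > 0 \<and>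
        (\<forall>z\<in>cball z\<^sub>0 \<epsilon>. edist z {z'. w\<^sub>0 \<in> F z'} \<le> ereal \<kappa> * edist w\<^sub>0 (F z \<inter> cball w\<^sub>0 \<delta>)))"

section \<open>Cone reducibility\<close>

(* The reduction space Z is a linear subspace of a Euclidean type, so that it may be {0}
   (as happens at interior points of K). *)
definition C2_cone_reduction ::
    "'b::euclidean_space set \<Rightarrow> 'b \<Rightarrow> 'b set \<Rightarrow> 'c::euclidean_space set \<Rightarrow> 'c set \<Rightarrow> ('b \<Rightarrow> 'c) \<Rightarrow> bool"
  where
  "C2_cone_reduction K y U Z D \<Xi> \<longleftrightarrow>
     open U \<and> y \<in> U \<and> subspace Z \<and>
     D \<subseteq> Z \<and> closed D \<and> convex D \<and> cone D \<and> D \<inter> uminus ` D = {0} \<and>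
     \<Xi> ` U \<subseteq> Z \<and> C2_on \<Xi> U \<and> \<Xi> y = 0 \<and>
     range (frechet_derivative \<Xi> (at y)) = Z \<and>
     K \<inter> U = {u \<in> U. \<Xi> u \<in> D}"

(* HOL cannot quantify over the type of the reduction space. Since the derivative of Xi maps
   the ambient space onto Z, every admissible Z is isometric to a subspace of the ambient
   space; quantifying over these loses nothing (lemma C2_cone_reduction_in_domain). *)
definition C2_cone_reducible :: "'b::euclidean_space set \<Rightarrow> bool" where
  "C2_cone_reducible K \<longleftrightarrow>
     (\<forall>y\<in>K. \<exists>(U :: 'b set) (Z :: 'b set) (D :: 'b set) (\<Xi> :: 'b \<Rightarrow> 'b). C2_cone_reduction K y U Z D \<Xi>)"

lemma C2_on_linear_compose:
  fixes f :: "'a::euclidean_space \<Rightarrow> 'b::euclidean_space" and h :: "'b \<Rightarrow> 'c::euclidean_space"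
  assumes "C2_on f S" and "linear h"
  shows "C2_on (h \<circ> f) S"
proof -
  obtain f' :: "'a \<Rightarrow> 'a \<Rightarrow>\<^sub>L 'b" and f'' :: "'a \<Rightarrow> 'a \<Rightarrow>\<^sub>L ('a \<Rightarrow>\<^sub>L 'b)" where
    d1: "\<And>x. x \<in> S \<Longrightarrow> (f has_derivative blinfun_apply (f' x)) (at x)" and
    d2: "\<And>x. x \<in> S \<Longrightarrow> (f' has_derivative blinfun_apply (f'' x)) (at x)" and
    c: "continuous_on S f''"
    using assms(1) unfolding C2_on_def by blast
  have bl: "bounded_linear h"
    using assms(2) by (simp add: linear_conv_bounded_linear)
  define H where "H = Blinfun h"
  have H: "blinfun_apply H = h"
    unfolding H_def by (rule bounded_linear_Blinfun_apply[OF bl])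
  define C :: "('a \<Rightarrow>\<^sub>L 'b) \<Rightarrow>\<^sub>L ('a \<Rightarrow>\<^sub>L 'c)" where "C = Blinfun (\<lambda>A. H o\<^sub>L A)"
  have blC: "bounded_linear (\<lambda>A :: 'a \<Rightarrow>\<^sub>L 'b. H o\<^sub>L A)"
    by (rule bounded_bilinear.bounded_linear_right[OF bounded_bilinear_blinfun_compose])
  have C: "blinfun_apply C = (\<lambda>A. H o\<^sub>L A)"
    unfolding C_def by (rule bounded_linear_Blinfun_apply[OF blC])
  have "((h \<circ> f) has_derivative blinfun_apply (H o\<^sub>L f' x)) (at x)" if "x \<in> S" for x
    using bounded_linear.has_derivative[OF bl d1[OF that]] by (simp add: H comp_def blinfun_compose.rep_eq)
  moreover have "((\<lambda>x. H o\<^sub>L f' x) has_derivative blinfun_apply (C o\<^sub>L f'' x)) (at x)"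
    if "x \<in> S" for x
    using bounded_linear.has_derivative[OF blC d2[OF that]] by (simp add: C comp_def blinfun_compose.rep_eq)
  moreover have "continuous_on S (\<lambda>x. C o\<^sub>L f'' x)"
    by (intro bounded_linear.continuous_on[OF
          bounded_bilinear.bounded_linear_right[OF bounded_bilinear_blinfun_compose]] c)
  ultimately show ?thesis
    unfolding C2_on_def by (intro exI[of _ "\<lambda>x. H o\<^sub>L f' x"] exI[of _ "\<lambda>x. C o\<^sub>L f'' x"]) simp
qed

lemma C2_cone_reduction_in_domain:
  fixes K :: "'b::euclidean_space set" and Z :: "'c::euclidean_space set"
  assumes red: "C2_cone_reduction K y U Z D \<Xi>"
  shows "\<exists>(Z' :: 'b set) D' \<Xi>'. C2_cone_reduction K y U Z' D' \<Xi>'"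
proof -
  have U: "open U" "y \<in> U" and Z: "subspace Z"
    and D: "D \<subseteq> Z" "closed D" "convex D" "cone D" "D \<inter> uminus ` D = {0}"
    and X: "\<Xi> ` U \<subseteq> Z" "C2_on \<Xi> U" "\<Xi> y = 0"
    and ra: "range (frechet_derivative \<Xi> (at y)) = Z"
    and K: "K \<inter> U = {u \<in> U. \<Xi> u \<in> D}"
    using red unfolding C2_cone_reduction_def by blast+
  have diff: "\<Xi> differentiable (at y)"
    using X(2) U(2) unfolding C2_on_def differentiable_def by blast
  have "dim Z \<le> DIM('b)"
    using dim_image_le[OF linear_frechet_derivative[OF diff], of UNIV] ra by simp
  then obtain T :: "'b set" where T: "subspace T" "dim T = dim Z"
    using choose_subspace_of_subspace[of "dim Z" "UNIV :: 'b set"] by auto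
  obtain f :: "'c \<Rightarrow> 'b" and h where f: "linear f" "linear h" "f ` Z = T" "h ` T = Z"
    and inv: "\<And>x. x \<in> Z \<Longrightarrow> h (f x) = x" "\<And>x. x \<in> T \<Longrightarrow> f (h x) = x"
    by (rule isometries_subspaces[OF Z T(1) T(2)[symmetric]]) blast
  have f0: "f 0 = 0" and fm: "\<And>x. f (- x) = - f x"
    using f(1) by (simp_all add: linear_0 linear_neg)
  have D': "f ` D = T \<inter> h -` D"
  proof
    show "f ` D \<subseteq> T \<inter> h -` D" using D(1) f(3) inv(1) by auto
    show "T \<inter> h -` D \<subseteq> f ` D"
    proof
      fix t assume "t \<in> T \<inter> h -` D"
      then have "t = f (h t)" "h t \<in> D" by (simp_all add: inv(2))
      then show "t \<in> f ` D" by (rule image_eqI)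
    qed
  qed
  have "closed (f ` D)"
    unfolding D'
    by (intro closed_Int closed_subspace T(1) closed_vimage D(2)
          linear_continuous_on[OF f(2)[unfolded linear_conv_bounded_linear]])
  moreover have "convex (f ` D)" by (rule convex_linear_image[OF f(1) D(3)])
  moreover have "cone (f ` D)"
    using D(4) unfolding cone_def by (auto simp: linear_cmul[OF f(1), symmetric])
  moreover have "f ` D \<inter> uminus ` f ` D = {0}"
  proof -
    have inj: "inj_on f Z" using inv(1) by (rule inj_on_inverseI)
    have m: "uminus ` f ` D = f ` uminus ` D" by (simp add: image_image fm)
    have "uminus ` D \<subseteq> Z" using D(1) Z by (auto simp: subspace_neg)
    then have "f ` D \<inter> f ` uminus ` D = f ` (D \<inter> uminus ` D)"
      using inj_on_image_Int[OF inj D(1)] by simp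
    then show ?thesis by (simp add: m D(5) f0)
  qed
  moreover have "f ` D \<subseteq> T" using D(1) f(3) by blast
  moreover have "(f \<circ> \<Xi>) ` U \<subseteq> T" using X(1) f(3) by (auto simp: image_comp[symmetric])
  moreover have "C2_on (f \<circ> \<Xi>) U" by (rule C2_on_linear_compose[OF X(2) f(1)])
  moreover have "(f \<circ> \<Xi>) y = 0" by (simp add: X(3) f0)
  moreover have "range (frechet_derivative (f \<circ> \<Xi>) (at y)) = T"
  proof -
    have "((f \<circ> \<Xi>) has_derivative (\<lambda>x. f (frechet_derivative \<Xi> (at y) x))) (at y)"
      using bounded_linear.has_derivative[OF f(1)[unfolded linear_conv_bounded_linear]
          diff[unfolded frechet_derivative_works]] by (simp add: comp_def)
    then have "frechet_derivative (f \<circ> \<Xi>) (at y) = (\<lambda>x. f (frechet_derivative \<Xi> (at y) x))"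
      by (rule frechet_derivative_at[symmetric])
    then show ?thesis by (simp add: image_image[symmetric] ra f(3))
  qed
  moreover have "K \<inter> U = {u \<in> U. (f \<circ> \<Xi>) u \<in> f ` D}"
  proof -
    have "(f \<circ> \<Xi>) u \<in> f ` D \<longleftrightarrow> \<Xi> u \<in> D" if "u \<in> U" for u
    proof -
      have "\<Xi> u \<in> Z" using X(1) that by blast
      then show ?thesis using f(3) inv(1) by (auto simp: D')
    qed
    then show ?thesis using K by auto
  qed
  ultimately show ?thesis
    unfolding C2_cone_reduction_def using U T(1) by blast
qed

section \<open>The constraint system\<close>

definition multipliers ::
    "('a::euclidean_space \<Rightarrow> 'b::euclidean_space) \<Rightarrow> 'b set \<Rightarrow> 'a \<Rightarrow> 'a \<Rightarrow> 'b set" where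
  "multipliers g K x v = {l \<in> limiting_normal_cone K (g x). v = nabla g x l}"

definition Gmap :: "('a \<Rightarrow> 'b::ab_group_add) \<Rightarrow> 'b set \<Rightarrow> 'a \<Rightarrow> 'b set" where
  "Gmap g K x = {g x - y | y. y \<in> K}"

definition KKT_map ::
    "('a::euclidean_space \<Rightarrow> 'b::euclidean_space) \<Rightarrow> 'b set \<Rightarrow> 'a \<times> 'b \<times> 'a \<Rightarrow> 'a \<times> 'b" where
  "KKT_map g K = (\<lambda>(x, l, v). (- v + nabla g x l, g x - closest_point K (g x + l)))"

end

theory Submission
  imports Defs
begin

text \<open>
  Write \<open>\<Gamma> = g -` K\<close> and \<open>\<Phi> = KKT_map g K\<close>.  Every zero \<open>(x', l', v')\<close> of \<open>\<Phi>\<close> yields a point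
  \<open>(x', v')\<close> of \<open>gph N\<^sub>\<Gamma>\<close>: its second component says that \<open>l'\<close> is normal to \<open>K\<close> at \<open>g x'\<close>, its first
  that \<open>v' = \<nabla>g(x') l'\<close>, and the pullback of a normal by the adjoint derivative is a regular normal
  to \<open>\<Gamma>\<close> (\<open>nabla_normal_in_regular_normal_cone\<close>).  So a direction \<open>(d, w)\<close> is tangent to \<open>gph N\<^sub>\<Gamma>\<close> as
  soon as zeros of \<open>\<Phi>\<close> can be found at distance \<open>o(t\<^sub>k)\<close> from points
  \<open>(x + t\<^sub>k d, l\<^sub>k, v + t\<^sub>k w)\<close>, for some \<open>t\<^sub>k \<down> 0\<close>.

  Metric subregularity provides such zeros once the residual \<open>\<Phi>(x + t\<^sub>k d, l\<^sub>k, v + t\<^sub>k w)\<close> is \<open>o(t\<^sub>k)\<close>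
  (\<open>metrically_subregular_zeros_near\<close>).  To arrange this, take \<open>l\<^sub>k = l + t\<^sub>k \<eta>\<^sub>k\<close> from a sequence
  \<open>(g x + t\<^sub>k y\<^sub>k, l + t\<^sub>k \<eta>\<^sub>k)\<close> in \<open>gph N\<^sub>K\<close> that witnesses \<open>\<eta> \<in> DN\<^sub>K(g x | l)(g'(x) d)\<close>.  The first
  component of the residual is \<open>o(t\<^sub>k)\<close> because \<open>w\<close> is the derivative of \<open>(z, m) \<mapsto> \<nabla>g(z) m\<close> at
  \<open>(x, l)\<close> in the direction \<open>(d, \<eta>)\<close>.  The map \<open>(y, m) \<mapsto> y - \<Pi>\<^sub>K(y + m)\<close> vanishes on \<open>gph N\<^sub>K\<close> and is
  2-Lipschitz in \<open>y\<close>, so the second component is at most twice the distance from \<open>g(x + t\<^sub>k d)\<close> to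
  \<open>g x + t\<^sub>k y\<^sub>k\<close>, which is \<open>o(t\<^sub>k)\<close> because both have the first-order term \<open>t\<^sub>k g'(x) d\<close>.
\<close>

section \<open>First-order expansions along sequences\<close>

lemma has_derivative_sequential_quotient:
  fixes f :: "'a::real_normed_vector \<Rightarrow> 'b::real_normed_vector"
  assumes f: "(f has_derivative f') (at x)"
    and t: "\<And>k. t k > 0" "t \<longlonglongrightarrow> 0" and u: "u \<longlonglongrightarrow> w"
  shows "(\<lambda>k. (f (x + t k *\<^sub>R u k) - f x) /\<^sub>R t k) \<longlonglongrightarrow> f' w"
proof -
  define e where "e y = (f y - f x - f' (y - x)) /\<^sub>R norm (y - x)" for y
  have bl: "bounded_linear f'" and e0: "(e \<longlongrightarrow> 0) (at x)"
    using f unfolding e_def[abs_def] has_derivative_at_within by auto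
  have "e x = 0" by (simp add: e_def)
  then have cont: "isCont e x" using e0 by (simp add: isCont_def)
  have "(\<lambda>k. x + t k *\<^sub>R u k) \<longlonglongrightarrow> x + 0 *\<^sub>R w" by (intro tendsto_intros t u)
  then have "(\<lambda>k. e (x + t k *\<^sub>R u k)) \<longlonglongrightarrow> 0"
    using isCont_tendsto_compose[OF cont] \<open>e x = 0\<close> by fastforce
  then have lim: "(\<lambda>k. f' (u k) + norm (u k) *\<^sub>R e (x + t k *\<^sub>R u k)) \<longlonglongrightarrow> f' w + norm w *\<^sub>R 0"
    by (intro tendsto_intros bounded_linear.tendsto[OF bl] u)
  have "(f (x + t k *\<^sub>R u k) - f x) /\<^sub>R t k = f' (u k) + norm (u k) *\<^sub>R e (x + t k *\<^sub>R u k)" for k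
  proof (cases "u k = 0")
    case True
    then show ?thesis by (simp add: linear_0[OF bounded_linear.linear[OF bl]])
  next
    case False
    have "norm (u k) * inverse (norm (t k *\<^sub>R u k)) = inverse (t k)"
      using False t(1)[of k] by (simp add: field_simps)
    then have "norm (u k) *\<^sub>R e (x + t k *\<^sub>R u k) = (f (x + t k *\<^sub>R u k) - f x - t k *\<^sub>R f' (u k)) /\<^sub>R t k"
      by (simp only: e_def scaleR_scaleR add_diff_cancel_left'
          linear_cmul[OF bounded_linear.linear[OF bl]])
    then show ?thesis using t(1)[of k] by (simp add: scaleR_diff_right)
  qed
  then show ?thesis using lim by simp
qed

text \<open>
  The form in which metric subregularity is used: points whose residual is \<open>o(t\<^sub>k)\<close> have zeros within
  \<open>o(t\<^sub>k)\<close>.  The distance to the zero set is only an infimum, so a further error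
  of order \<open>t\<^sub>k\<^sup>2\<close> is allowed for.
\<close>

lemma metrically_subregular_zeros_near:
  fixes F :: "'a::real_normed_vector \<Rightarrow> 'b::real_normed_vector"
  assumes sub: "metrically_subregular (\<lambda>p. {F p}) z 0"
    and t: "\<And>k. t k > 0" "t \<longlonglongrightarrow> 0" and p: "p \<longlonglongrightarrow> z"
    and res: "(\<lambda>k. F (p k) /\<^sub>R t k) \<longlonglongrightarrow> 0"
  obtains q where "\<And>k. F (q k) = 0" and "(\<lambda>k. (q k - p k) /\<^sub>R t k) \<longlonglongrightarrow> 0"
proof -
  obtain \<kappa> \<epsilon> \<delta> :: real where F0: "F z = 0" and pos: "\<kappa> \<ge> 0" "\<epsilon> > 0" "\<delta> > 0"
    and le: "\<And>y. y \<in> cball z \<epsilon> \<Longrightarrow>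
               edist y {z'. 0 \<in> {F z'}} \<le> ereal \<kappa> * edist 0 ({F y} \<inter> cball 0 \<delta>)"
    using sub unfolding metrically_subregular_def by auto
  have near: "\<exists>q. F q = 0 \<and> norm (q - p k) < \<kappa> * norm (F (p k)) + (t k)\<^sup>2"
    if "dist (p k) z < \<epsilon>" and "norm (F (p k)) < \<delta>" for k
  proof -
    have "p k \<in> cball z \<epsilon>" using that by (simp add: dist_commute)
    then have "edist (p k) {z'. 0 \<in> {F z'}} \<le> ereal \<kappa> * edist 0 ({F (p k)} \<inter> cball 0 \<delta>)"
      by (rule le)
    also have "{F (p k)} \<inter> cball 0 \<delta> = {F (p k)}" using that by auto
    also have "ereal \<kappa> * edist 0 {F (p k)} = ereal (\<kappa> * norm (F (p k)))"
      by (simp add: edist_def)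
    also have "\<dots> < ereal (\<kappa> * norm (F (p k)) + (t k)\<^sup>2)" using t(1)[of k] by simp
    finally show ?thesis
      by (auto simp: edist_def INF_less_iff dist_norm norm_minus_commute)
  qed
  \<comment> \<open>For the finitely many indices that are not yet in the region of validity, the base point \<open>z\<close>
      itself serves as the zero.\<close>
  have "\<forall>k. \<exists>q. F q = 0 \<and> (dist (p k) z < \<epsilon> \<and> norm (F (p k)) < \<delta> \<longrightarrow>
                norm (q - p k) < \<kappa> * norm (F (p k)) + (t k)\<^sup>2)"
    using near F0 by blast
  then obtain q where q: "\<And>k. F (q k) = 0"
    "\<And>k. dist (p k) z < \<epsilon> \<Longrightarrow> norm (F (p k)) < \<delta> \<Longrightarrow>
          norm (q k - p k) < \<kappa> * norm (F (p k)) + (t k)\<^sup>2"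
    by metis
  have "(\<lambda>k. t k *\<^sub>R (F (p k) /\<^sub>R t k)) \<longlonglongrightarrow> 0 *\<^sub>R 0" by (intro tendsto_intros t res)
  then have "(\<lambda>k. F (p k)) \<longlonglongrightarrow> 0" using t(1) by (simp add: less_imp_neq[symmetric])
  then have "\<forall>\<^sub>F k in sequentially. norm (F (p k)) < \<delta>"
    using tendstoD[OF _ pos(3)] by fastforce
  then have ev: "\<forall>\<^sub>F k in sequentially.
      norm ((q k - p k) /\<^sub>R t k) \<le> \<kappa> * norm (F (p k) /\<^sub>R t k) + t k"
    using tendstoD[OF p pos(2)]
  proof eventually_elim
    case (elim k)
    have "norm (q k - p k) / t k \<le> (\<kappa> * norm (F (p k)) + (t k)\<^sup>2) / t k"
      using q(2)[OF elim(2,1)] t(1)[of k] by (intro divide_right_mono) auto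
    also have "\<dots> = \<kappa> * (norm (F (p k)) / t k) + t k"
      using t(1)[of k] by (simp add: add_divide_distrib power2_eq_square)
    finally show ?case
      using t(1)[of k] by (simp only: norm_scaleR) (simp add: divide_inverse mult.commute)
  qed
  have "(\<lambda>k. \<kappa> * norm (F (p k) /\<^sub>R t k) + t k) \<longlonglongrightarrow> \<kappa> * norm (0::'b) + 0"
    by (intro tendsto_intros t res)
  then have "(\<lambda>k. (q k - p k) /\<^sub>R t k) \<longlonglongrightarrow> 0"
    using Lim_null_comparison[OF ev] by simp
  then show ?thesis using that q(1) by blast
qed

section \<open>Normals to convex sets and the projection\<close>

lemma regular_normal_cone_convex_le:
  fixes K :: "'b::real_inner set"
  assumes "convex K" and l: "l \<in> regular_normal_cone K y" and z: "z \<in> K"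
  shows "l \<bullet> (z - y) \<le> 0"
proof (rule ccontr)
  assume pos: "\<not> l \<bullet> (z - y) \<le> 0"
  have y: "y \<in> K" and ls: "Limsup (at y within K) (\<lambda>y'. ereal (l \<bullet> (y' - y) / norm (y' - y))) \<le> 0"
    using l by (auto simp: regular_normal_cone_def)
  have ne: "z \<noteq> y" using pos by auto
  \<comment> \<open>Along the segment from \<open>y\<close> to \<open>z\<close> the quotient in the limsup is constant and positive.\<close>
  define c where "c = l \<bullet> (z - y) / norm (z - y)"
  have "c > 0" using pos ne by (simp add: c_def)
  then have ev: "\<forall>\<^sub>F y' in at y within K. l \<bullet> (y' - y) / norm (y' - y) < c"
    using ls[unfolded Limsup_le_iff, rule_format, of "ereal c"] by simp
  define s where "s n = y + (1 / real (Suc n)) *\<^sub>R (z - y)" for n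
  have "(\<lambda>n. y + (1 / real (Suc n)) *\<^sub>R (z - y)) \<longlonglongrightarrow> y + 0 *\<^sub>R (z - y)"
    by (intro tendsto_intros LIMSEQ_Suc[OF lim_1_over_n])
  then have "s \<longlonglongrightarrow> y" by (simp add: s_def[abs_def])
  moreover have "s n \<in> K" for n
    using convexD_alt[OF \<open>convex K\<close> y z, of "1 / real (Suc n)"]
    by (simp add: s_def algebra_simps)
  moreover have "s n \<noteq> y" for n using ne by (simp add: s_def)
  ultimately have "filterlim s (at y within K) sequentially"
    by (simp add: filterlim_at)
  with ev have "\<forall>\<^sub>F n in sequentially. l \<bullet> (s n - y) / norm (s n - y) < c"
    by (rule eventually_compose_filterlim)
  moreover have "l \<bullet> (s n - y) / norm (s n - y) = c" for n
    by (simp add: s_def c_def)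
  ultimately show False by simp
qed

lemma limiting_normal_cone_convexD:
  fixes K :: "'b::real_inner set"
  assumes "closed K" and "convex K" and "l \<in> limiting_normal_cone K y"
  shows "y \<in> K" and "\<And>z. z \<in> K \<Longrightarrow> l \<bullet> (z - y) \<le> 0"
proof -
  obtain s u where s: "\<And>k. s k \<in> K" "s \<longlonglongrightarrow> y" and u: "u \<longlonglongrightarrow> l"
    and r: "\<And>k. u k \<in> regular_normal_cone K (s k)"
    using assms(3) unfolding limiting_normal_cone_def by blast
  show "y \<in> K" using closed_sequentially[OF assms(1)] s by blast
  fix z assume z: "z \<in> K"
  have "(\<lambda>k. u k \<bullet> (z - s k)) \<longlonglongrightarrow> l \<bullet> (z - y)" by (intro tendsto_intros u s)
  moreover have "u k \<bullet> (z - s k) \<le> 0" for k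
    by (rule regular_normal_cone_convex_le[OF assms(2) r z])
  ultimately show "l \<bullet> (z - y) \<le> 0" by (intro LIMSEQ_le_const2) auto
qed

lemma regular_normal_cone_subset_limiting:
  "regular_normal_cone \<Omega> z \<subseteq> limiting_normal_cone \<Omega> z"
proof
  fix v assume v: "v \<in> regular_normal_cone \<Omega> z"
  then have "z \<in> \<Omega>" by (simp add: regular_normal_cone_def)
  with v show "v \<in> limiting_normal_cone \<Omega> z"
    unfolding limiting_normal_cone_def
    by (intro CollectI exI[where x = "\<lambda>_. z"] exI[where x = "\<lambda>_. v"]) simp
qed

lemma closest_point_eq_if_normal:
  fixes K :: "'b::euclidean_space set"
  assumes "closed K" and "convex K" and "y \<in> K" and n: "\<And>z. z \<in> K \<Longrightarrow> l \<bullet> (z - y) \<le> 0"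
  shows "closest_point K (y + l) = y"
proof (rule closest_point_unique[symmetric, OF assms(2,1,3)], rule ballI)
  fix z assume "z \<in> K"
  have "(norm (l - (z - y)))\<^sup>2 = (norm l)\<^sup>2 + (norm (z - y))\<^sup>2 - 2 * (l \<bullet> (z - y))"
    by (simp add: power2_norm_eq_inner inner_diff inner_commute)
  then have "(norm l)\<^sup>2 \<le> (norm (l - (z - y)))\<^sup>2"
    using n[OF \<open>z \<in> K\<close>] zero_le_power2[of "norm (z - y)"] by linarith
  then have "norm l \<le> norm (l - (z - y))" by (rule power2_le_imp_le) simp
  then show "dist (y + l) y \<le> dist (y + l) z" by (simp add: dist_norm algebra_simps)
qed

lemma normal_if_closest_point_eq:
  fixes K :: "'b::euclidean_space set"
  assumes "closed K" and "convex K" and "K \<noteq> {}" and y: "closest_point K (y + l) = y"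
  shows "y \<in> K" and "\<And>z. z \<in> K \<Longrightarrow> l \<bullet> (z - y) \<le> 0"
proof -
  show "y \<in> K" using closest_point_in_set[OF assms(1,3), of "y + l"] y by simp
  fix z assume "z \<in> K"
  then show "l \<bullet> (z - y) \<le> 0"
    using closest_point_dot[OF assms(2,1), of z "y + l"] y by simp
qed

section \<open>Gradients, Hessians and pulled-back normals\<close>

lemma inner_nabla:
  fixes f :: "'a::euclidean_space \<Rightarrow> 'b::euclidean_space"
  assumes "(f has_derivative f') (at x)"
  shows "nabla f x l \<bullet> h = l \<bullet> f' h"
  using adjoint_works[of f' h l] assms frechet_derivative_at[OF assms] has_derivative_linear[OF assms]
  by (simp add: nabla_def inner_commute)

lemma nabla_eq_sum_Basis:
  fixes f :: "'a::euclidean_space \<Rightarrow> 'b::euclidean_space"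
  assumes "(f has_derivative f') (at x)"
  shows "nabla f x l = (\<Sum>b\<in>Basis. (l \<bullet> f' b) *\<^sub>R b)"
  using euclidean_representation[of "nabla f x l"] by (simp add: inner_nabla[OF assms])

text \<open>
  Holds because \<open>l\<close> is nonpositive on the increments \<open>g z - g x\<close> with \<open>g z \<in> K\<close>, and these
  agree with \<open>g'(x)(z - x)\<close> up to \<open>o(norm (z - x))\<close>.
\<close>

lemma nabla_normal_in_regular_normal_cone:
  fixes g :: "'a::euclidean_space \<Rightarrow> 'b::euclidean_space"
  assumes g: "(g has_derivative g') (at x)"
    and x: "g x \<in> K" and n: "\<And>y. y \<in> K \<Longrightarrow> l \<bullet> (y - g x) \<le> 0"
  shows "nabla g x l \<in> regular_normal_cone (g -` K) x"
proof -
  define e where "e z = (g z - g x - g' (z - x)) /\<^sub>R norm (z - x)" for z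
  have "(e \<longlongrightarrow> 0) (at x within g -` K)"
    using has_derivative_at_withinI[OF g, of "g -` K"]
    unfolding e_def[abs_def] has_derivative_at_within by auto
  then have lim: "((\<lambda>z. - (l \<bullet> e z)) \<longlongrightarrow> 0) (at x within g -` K)"
    by (auto intro!: tendsto_eq_intros)
  have le: "nabla g x l \<bullet> (z - x) / norm (z - x) \<le> - (l \<bullet> e z)" if "g z \<in> K" for z
  proof -
    have "nabla g x l \<bullet> (z - x) / norm (z - x) = l \<bullet> (g z - g x) / norm (z - x) - l \<bullet> e z"
      unfolding inner_nabla[OF g] e_def by (simp add: inner_diff_right divide_inverse algebra_simps)
    also have "l \<bullet> (g z - g x) / norm (z - x) \<le> 0"
      using n[OF that] by (simp add: divide_nonpos_nonneg)
    finally show ?thesis by simp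
  qed
  have "Limsup (at x within g -` K) (\<lambda>z. ereal (nabla g x l \<bullet> (z - x) / norm (z - x))) \<le> 0"
    unfolding Limsup_le_iff
  proof (intro allI impI)
    fix c :: ereal assume "0 < c"
    then obtain r where r: "0 < ereal r" "ereal r < c" using ereal_dense2 by blast
    have "\<forall>\<^sub>F z in at x within g -` K. - (l \<bullet> e z) < r"
      using order_tendstoD(2)[OF lim] r by simp
    moreover have "\<forall>\<^sub>F z in at x within g -` K. z \<in> g -` K"
      by (simp add: eventually_at_filter)
    ultimately show "\<forall>\<^sub>F z in at x within g -` K.
        ereal (nabla g x l \<bullet> (z - x) / norm (z - x)) < c"
    proof eventually_elim
      case (elim z)
      then have "nabla g x l \<bullet> (z - x) / norm (z - x) < r" using le[of z] by simp
      then show ?case using r(2) less_trans by (metis less_ereal.simps(1))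
    qed
  qed
  then show ?thesis using x by (simp add: regular_normal_cone_def)
qed

text \<open>
  The map is bilinear in \<open>(g'(z), m)\<close>: its partial derivative in \<open>z\<close> is the Hessian of \<open>l \<bullet> g\<close>, since
  the gradient of \<open>l \<bullet> g\<close> at \<open>z\<close> is \<open>\<nabla>g(z) l\<close>, and in \<open>m\<close> it is linear.
\<close>

lemma has_derivative_nabla_pair:
  fixes g :: "'a::euclidean_space \<Rightarrow> 'b::euclidean_space"
  assumes "C2_on g UNIV"
  shows "((\<lambda>(z, m). nabla g z m) has_derivative
           (\<lambda>(d, \<eta>). hessian (\<lambda>z. l \<bullet> g z) x d + nabla g x \<eta>)) (at (x, l))"
proof -
  obtain g' :: "'a \<Rightarrow> 'a \<Rightarrow>\<^sub>L 'b" and g'' :: "'a \<Rightarrow> 'a \<Rightarrow>\<^sub>L ('a \<Rightarrow>\<^sub>L 'b)" where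
    d1: "\<And>z. (g has_derivative blinfun_apply (g' z)) (at z)" and
    d2: "\<And>z. (g' has_derivative blinfun_apply (g'' z)) (at z)"
    using assms unfolding C2_on_def by blast
  note nab = nabla_eq_sum_Basis[OF d1]
  have grad: "nabla (\<lambda>z. l \<bullet> g z) z 1 = nabla g z l" for z
    using nabla_eq_sum_Basis[OF has_derivative_inner_right[OF d1[of z], of l], of 1]
    by (simp add: nab)
  define H where "H d = (\<Sum>b\<in>Basis. (l \<bullet> g'' x d b) *\<^sub>R b)" for d
  have "((\<lambda>z. nabla g z l) has_derivative H) (at x)"
    unfolding nab H_def[abs_def]
    by (rule derivative_eq_intros refl d2
        bounded_linear.has_derivative[OF bounded_linear_blinfun_apply])+ simp
  then have hess: "hessian (\<lambda>z. l \<bullet> g z) x = H"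
    unfolding hessian_def grad by (rule frechet_derivative_at[symmetric])
  have "((\<lambda>p. g' (fst p)) has_derivative (\<lambda>h. g'' x (fst h))) (at (x, l))"
    by (rule has_derivative_compose[OF has_derivative_fst[OF has_derivative_ident]]) (simp add: d2)
  then have d3: "((\<lambda>p. blinfun_apply (g' (fst p)) b) has_derivative (\<lambda>h. g'' x (fst h) b)) (at (x, l))" for b
    by (rule bounded_linear.has_derivative[OF blinfun.bounded_linear_left])
  have "((\<lambda>p. \<Sum>b\<in>Basis. (snd p \<bullet> g' (fst p) b) *\<^sub>R b) has_derivative
      (\<lambda>h. \<Sum>b\<in>Basis. (l \<bullet> g'' x (fst h) b + snd h \<bullet> g' x b) *\<^sub>R b)) (at (x, l))"
    by (rule derivative_eq_intros refl d3)+ simp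
  then show ?thesis
    by (simp add: case_prod_unfold nab hess H_def scaleR_add_left sum.distrib)
qed

section \<open>Tangents to the graph of the normal cone mapping\<close>

theorem proposition3p1:
  fixes g :: "'a::euclidean_space \<Rightarrow> 'b::euclidean_space"
    and K :: "'b set"
    and x v :: 'a
  assumes "C2_on g UNIV"
    and "K \<noteq> {}" and "closed K" and "convex K"
    and "C2_cone_reducible K"
    and "(x, v) \<in> gph (limiting_normal_cone (g -` K))"
    and "metrically_subregular (Gmap g K) x 0"
    and "\<forall>l \<in> multipliers g K x v. metrically_subregular (\<lambda>p. {KKT_map g K p}) (x, l, v) 0"
  shows "(\<Union>l \<in> multipliers g K x v.
            {(d, w). \<exists>\<eta> \<in> graphical_derivative (limiting_normal_cone K) (g x) l
                            (frechet_derivative g (at x) d).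
                       w = hessian (\<lambda>z. l \<bullet> g z) x d + nabla g x \<eta>})
         \<subseteq> contingent_cone (gph (limiting_normal_cone (g -` K))) (x, v)"
proof clarify
  fix l d \<eta>
  assume l: "l \<in> multipliers g K x v"
    and \<eta>: "\<eta> \<in> graphical_derivative (limiting_normal_cone K) (g x) l (frechet_derivative g (at x) d)"
  define w where "w = hessian (\<lambda>z. l \<bullet> g z) x d + nabla g x \<eta>"
  define g' where "g' z = frechet_derivative g (at z)" for z
  have g': "(g has_derivative g' z) (at z)" for z
    using assms(1) unfolding C2_on_def g'_def
    by (metis UNIV_I differentiableI frechet_derivative_works)
  have v: "v = nabla g x l" using l by (simp add: multipliers_def)

  obtain t :: "nat \<Rightarrow> real" and u where t: "\<And>k. t k > 0" "t \<longlonglongrightarrow> 0" and u: "u \<longlonglongrightarrow> (g' x d, \<eta>)"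
    and mem: "\<And>k. (g x, l) + t k *\<^sub>R u k \<in> gph (limiting_normal_cone K)"
    using \<eta> unfolding graphical_derivative_def contingent_cone_def g'_def by blast
  define y where "y k = g x + t k *\<^sub>R fst (u k)" for k
  define m where "m k = l + t k *\<^sub>R snd (u k)" for k
  have norm_ym: "m k \<in> limiting_normal_cone K (y k)" for k
    using mem[of k] by (cases "u k") (simp add: gph_def y_def m_def)
  have ut: "(\<lambda>k. fst (u k)) \<longlonglongrightarrow> g' x d" "(\<lambda>k. snd (u k)) \<longlonglongrightarrow> \<eta>"
    using tendsto_fst[OF u] tendsto_snd[OF u] by simp_all

  define p where "p k = (x + t k *\<^sub>R d, m k, v + t k *\<^sub>R w)" for k
  have "p \<longlonglongrightarrow> (x + 0 *\<^sub>R d, l + 0 *\<^sub>R \<eta>, v + 0 *\<^sub>R w)"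
    unfolding p_def[abs_def] m_def by (intro tendsto_intros t ut)
  then have p: "p \<longlonglongrightarrow> (x, l, v)" by simp

  have "(\<lambda>k. (nabla g (x + t k *\<^sub>R d) (m k) - v) /\<^sub>R t k) \<longlonglongrightarrow> w"
    using has_derivative_sequential_quotient[OF has_derivative_nabla_pair[OF assms(1), of l x] t,
        of "\<lambda>k. (d, snd (u k))" "(d, \<eta>)"] ut
    by (simp add: tendsto_Pair m_def v w_def)
  then have "(\<lambda>k. (nabla g (x + t k *\<^sub>R d) (m k) - v) /\<^sub>R t k - w) \<longlonglongrightarrow> 0"
    by (simp add: LIM_zero)
  then have res1: "(\<lambda>k. fst (KKT_map g K (p k)) /\<^sub>R t k) \<longlonglongrightarrow> 0"
    using t(1) by (simp add: KKT_map_def p_def algebra_simps less_imp_neq[symmetric])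

  have "(\<lambda>k. (g (x + t k *\<^sub>R d) - g x) /\<^sub>R t k - fst (u k)) \<longlonglongrightarrow> g' x d - g' x d"
    by (intro tendsto_diff ut has_derivative_sequential_quotient[OF g' t]) simp
  moreover have "(g (x + t k *\<^sub>R d) - g x) /\<^sub>R t k - fst (u k) = (g (x + t k *\<^sub>R d) - y k) /\<^sub>R t k" for k
    using t(1)[of k] by (simp add: y_def algebra_simps)
  ultimately have gy: "(\<lambda>k. (g (x + t k *\<^sub>R d) - y k) /\<^sub>R t k) \<longlonglongrightarrow> 0" by simp
  have bound: "norm (snd (KKT_map g K (p k)) /\<^sub>R t k) \<le> 2 * norm ((g (x + t k *\<^sub>R d) - y k) /\<^sub>R t k)" for k
  proof -
    let ?z = "g (x + t k *\<^sub>R d)" and ?P = "closest_point K"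
    have "?P (y k + m k) = y k"
      using limiting_normal_cone_convexD[OF assms(3,4) norm_ym[of k]]
      by (intro closest_point_eq_if_normal[OF assms(3,4)])
    then have "norm (?z - ?P (?z + m k)) \<le> norm (?z - y k) + dist (?P (y k + m k)) (?P (?z + m k))"
      by (metis dist_norm dist_triangle)
    also have "dist (?P (y k + m k)) (?P (?z + m k)) \<le> norm (?z - y k)"
      using closest_point_lipschitz[OF assms(4,3,2), of "y k + m k" "?z + m k"]
      by (simp add: dist_norm norm_minus_commute)
    finally have "norm (?z - ?P (?z + m k)) \<le> 2 * norm (?z - y k)" by simp
    from mult_left_mono[OF this, of "inverse (t k)"] show ?thesis
      using t(1)[of k] by (simp add: KKT_map_def p_def)
  qed
  have res2: "(\<lambda>k. snd (KKT_map g K (p k)) /\<^sub>R t k) \<longlonglongrightarrow> 0"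
    by (rule Lim_null_comparison[OF always_eventually[OF allI[OF bound]]])
       (use tendsto_mult_right_zero[OF tendsto_norm_zero[OF gy]] in simp)
  have res: "(\<lambda>k. KKT_map g K (p k) /\<^sub>R t k) \<longlonglongrightarrow> 0"
    using tendsto_Pair[OF res1 res2] by (simp add: scaleR_prod_def zero_prod_def)

  obtain q where q0: "\<And>k. KKT_map g K (q k) = 0" and q: "(\<lambda>k. (q k - p k) /\<^sub>R t k) \<longlonglongrightarrow> 0"
    using metrically_subregular_zeros_near[OF assms(8)[rule_format, OF l] t p res] by blast
  define x' l' v' where "x' k = fst (q k)" and "l' k = fst (snd (q k))" and "v' k = snd (snd (q k))" for k
  have graph: "(x' k, v' k) \<in> gph (limiting_normal_cone (g -` K))" for k
  proof -
    have "q k = (x' k, l' k, v' k)" by (simp add: x'_def l'_def v'_def)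
    then have "v' k = nabla g (x' k) (l' k)" and "closest_point K (g (x' k) + l' k) = g (x' k)"
      using q0[of k] by (simp_all add: KKT_map_def zero_prod_def)
    then have "v' k \<in> regular_normal_cone (g -` K) (x' k)"
      using nabla_normal_in_regular_normal_cone[OF g'] normal_if_closest_point_eq[OF assms(3,4,2)]
      by simp
    then show ?thesis using regular_normal_cone_subset_limiting by (auto simp: gph_def)
  qed
  define a where "a k = ((x' k - x) /\<^sub>R t k, (v' k - v) /\<^sub>R t k)" for k
  have "(\<lambda>k. fst ((q k - p k) /\<^sub>R t k) + d) \<longlonglongrightarrow> 0 + d"
    using tendsto_fst[OF q] by (intro tendsto_intros) simp
  moreover have "(\<lambda>k. snd (snd ((q k - p k) /\<^sub>R t k)) + w) \<longlonglongrightarrow> 0 + w"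
    using tendsto_snd[OF tendsto_snd[OF q]] by (intro tendsto_intros) simp
  ultimately have "a \<longlonglongrightarrow> (d, w)"
    unfolding a_def[abs_def] using t(1)
    by (intro tendsto_Pair)
       (simp_all add: x'_def l'_def v'_def p_def algebra_simps less_imp_neq[symmetric])
  moreover have "(x, v) + t k *\<^sub>R a k \<in> gph (limiting_normal_cone (g -` K))" for k
    using graph[of k] t(1)[of k] by (simp add: a_def)
  ultimately show "(d, hessian (\<lambda>z. l \<bullet> g z) x d + nabla g x \<eta>)
      \<in> contingent_cone (gph (limiting_normal_cone (g -` K))) (x, v)"
    using t unfolding contingent_cone_def w_def by blast
qed

end
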